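(* Let $U = \{1,2,3,4,5,6\}$ and $V = \{a,b\}$ (with $a \neq b$). Let $R_1$ be the equivalence relation on $U$ whose equivalence classes are $\{1\}, \{2\}, \{3\}, \{4,5,6\}$, and let $R_2$ be the equivalence relation on $U$ whose equivalence classes are $\{3\}, \{1,2,4,5,6\}$. Define $f : U \to V$ by $$f(1)=f(2)=f(5)=f(6)=a, \qquad f(3)=f(4)=b.$$ Then $R_1 \subseteq R_2$. However, $$f(R_1) = \{(a,a),(b,b),(a,b),(b,a)\}, \qquad f(R_2) = \{(a,a),(b,b)\},$$ and as a result $f(R_2) \subseteq f(R_1)$.
   Context: Equivalence relations on a set $U$ are regarded as subsets of $U \times U$. For an equivalence relation $R$ on a finite nonempty set $U$ and $x \in U$, write $[x]_R = \{y \in U \mid (x,y) \in R\}$. Given a surjective mapping $f : U \to V$ between finite sets, write $[x]_f = \{y \in U \mid f(y) = f(x)\}$ for $x \in U$. The including degree of $[x]_R$ with respect to $[x]_f$ is $D([x]_R/[x]_f) = |[x]_f \cap [x]_R|/|[x]_f|$, where $|S|$ denotes the cardinality of a set $S$. For an equivalence relation $R$ on $U$, the general relation mapping induced by $f$ (denoted by the same letter $f$) sends $R$ to the relation on $V$ $$f(R) = \{(f(x), f(y)) \mid (x,y) \in R \text{ and } D([x]_R/[x]_f) = D([y]_R/[y]_f)\}.$$ *)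

theory Defs
  imports Complex_Main
begin

definition rel_class :: "'u set \<Rightarrow> ('u \<times> 'u) set \<Rightarrow> 'u \<Rightarrow> 'u set" where
  "rel_class U R x = {y \<in> U. (x, y) \<in> R}"

definition map_class :: "'u set \<Rightarrow> ('u \<Rightarrow> 'v) \<Rightarrow> 'u \<Rightarrow> 'u set" where
  "map_class U f x = {y \<in> U. f y = f x}"

definition including_degree :: "'u set \<Rightarrow> ('u \<Rightarrow> 'v) \<Rightarrow> ('u \<times> 'u) set \<Rightarrow> 'u \<Rightarrow> real" where
  "including_degree U f R x =
     real (card (map_class U f x \<inter> rel_class U R x)) / real (card (map_class U f x))"

definition relation_mapping :: "'u set \<Rightarrow> ('u \<Rightarrow> 'v) \<Rightarrow> ('u \<times> 'u) set \<Rightarrow> ('v \<times> 'v) set" where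
  "relation_mapping U f R =
     {(f x, f y) | x y. (x, y) \<in> R \<and> including_degree U f R x = including_degree U f R y}"

end

theory Submission imports Defs begin

text \<open>An equivalence relation is the union of the squares of its classes, so both relations
  are explicit finite sets. The fibres of \<open>f\<close> are {1,2,5,6} over \<open>a\<close> and
  {3,4} over \<open>b\<close>. For \<open>R1\<close> the degree is 1/4 at 1 and 2 and 1/2 elsewhere,
  hence constant on every class: no pair is lost, and (4,5), (5,4) yield the mixed pairs. For
  \<open>R2\<close> the degree is 1 over \<open>a\<close> and 1/2 over \<open>b\<close>, so the
  large class loses exactly the pairs joining 4 to the other fibre, and only diagonal pairs remain.
  Enlarging the relation thus shrinks its image.\<close>

lemma equiv_eq_Union_quotient:
  assumes "equiv A r"
  shows "r = (\<Union>C\<in>A // r. C \<times> C)"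
proof
  show "r \<subseteq> (\<Union>C\<in>A // r. C \<times> C)"
  proof (rule subrelI)
    fix x y
    assume xy: "(x, y) \<in> r"
    then have "x \<in> A"
      using assms equiv_type by blast
    then have "r `` {x} \<in> A // r" "x \<in> r `` {x}" "y \<in> r `` {x}"
      using xy equiv_class_self[OF assms] by (auto intro: quotientI)
    then show "(x, y) \<in> (\<Union>C\<in>A // r. C \<times> C)"
      by blast
  qed
next
  show "(\<Union>C\<in>A // r. C \<times> C) \<subseteq> r"
    using quotient_eq_iff[OF assms] by fast
qed

text \<open>Classes are disjoint, so any class containing \<open>x\<close> is the class of
  \<open>x\<close>. This reads classes directly off the given quotients.\<close>

lemma rel_class_eq_quotient_member:
  assumes "equiv U R" "C \<in> U // R" "x \<in> C"
  shows "rel_class U R x = C"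
proof -
  have "rel_class U R x = R `` {x}"
    using equiv_type[OF assms(1)] by (auto simp: rel_class_def)
  also have "\<dots> = C"
    using assms by (auto simp: quotient_eq_iff[OF assms(1)] dest: in_quotient_imp_closed
      in_quotient_imp_in_rel)
  finally show ?thesis .
qed

theorem mainTheorem1:
  fixes U :: "nat set" and V :: "'v set" and a b :: 'v
    and R1 R2 :: "(nat \<times> nat) set" and f :: "nat \<Rightarrow> 'v"
  assumes U: "U = {1, 2, 3, 4, 5, 6}"
    and V: "V = {a, b}" and ab: "a \<noteq> b"
    and R1: "equiv U R1" "U // R1 = {{1}, {2}, {3}, {4, 5, 6}}"
    and R2: "equiv U R2" "U // R2 = {{3}, {1, 2, 4, 5, 6}}"
    and f_surj: "f ` U = V"
    and f_a: "f 1 = a" "f 2 = a" "f 5 = a" "f 6 = a"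
    and f_b: "f 3 = b" "f 4 = b"
  shows "R1 \<subseteq> R2
    \<and> relation_mapping U f R1 = {(a, a), (b, b), (a, b), (b, a)}
    \<and> relation_mapping U f R2 = {(a, a), (b, b)}
    \<and> relation_mapping U f R2 \<subseteq> relation_mapping U f R1"
proof -
  have R1_eq: "R1 = {(1, 1), (2, 2), (3, 3)} \<union> {4, 5, 6} \<times> {4, 5, 6}"
    by (subst equiv_eq_Union_quotient[OF R1(1)]) (auto simp: R1(2))
  have R2_eq: "R2 = {(3, 3)} \<union> {1, 2, 4, 5, 6} \<times> {1, 2, 4, 5, 6}"
    by (subst equiv_eq_Union_quotient[OF R2(1)]) (auto simp: R2(2))
  have fibre_a: "map_class U f x = {1, 2, 5, 6}" if "x \<in> {1, 2, 5, 6}" for x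
    using that f_a f_b ab unfolding map_class_def U by auto
  have fibre_b: "map_class U f x = {3, 4}" if "x \<in> {3, 4}" for x
    using that f_a f_b ab unfolding map_class_def U by auto
  have class1: "rel_class U R1 1 = {1}" "rel_class U R1 2 = {2}" "rel_class U R1 3 = {3}"
    by (rule rel_class_eq_quotient_member[OF R1(1)]; simp add: R1(2))+
  have class1_456: "rel_class U R1 x = {4, 5, 6}" if "x \<in> {4, 5, 6}" for x
    by (rule rel_class_eq_quotient_member[OF R1(1) _ that]) (simp add: R1(2))
  have class2: "rel_class U R2 3 = {3}"
    by (rule rel_class_eq_quotient_member[OF R2(1)]) (simp_all add: R2(2))
  have class2_12456: "rel_class U R2 x = {1, 2, 4, 5, 6}" if "x \<in> {1, 2, 4, 5, 6}" for x
    by (rule rel_class_eq_quotient_member[OF R2(1) _ that]) (simp add: R2(2))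
  have deg1: "including_degree U f R1 1 = 1/4" "including_degree U f R1 2 = 1/4"
    "including_degree U f R1 3 = 1/2" "including_degree U f R1 4 = 1/2"
    "including_degree U f R1 5 = 1/2" "including_degree U f R1 6 = 1/2"
    \<comment> \<open>With \<open>One_nat_def\<close> active, the point \<open>1\<close> would turn
      into \<open>Suc 0\<close> and \<open>class1\<close> would no longer match.\<close>
    by (simp_all add: including_degree_def fibre_a fibre_b class1 class1_456 del: One_nat_def)
  have deg2: "including_degree U f R2 1 = 1" "including_degree U f R2 2 = 1"
    "including_degree U f R2 3 = 1/2" "including_degree U f R2 4 = 1/2"
    "including_degree U f R2 5 = 1" "including_degree U f R2 6 = 1"
    by (simp_all add: including_degree_def fibre_a fibre_b class2 class2_12456 del: One_nat_def)
  \<comment> \<open>Separates the degree condition from the image, so that only the filtered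
    relations have to be determined.\<close>
  have image_eq: "relation_mapping U f R =
      map_prod f f ` {(x, y) \<in> R. including_degree U f R x = including_degree U f R y}" for R
    unfolding relation_mapping_def by force
  \<comment> \<open>The filter is vacuous here, as degrees agree within each class of
    \<open>R1\<close>.\<close>
  have "{(x, y) \<in> R1. including_degree U f R1 x = including_degree U f R1 y} = R1"
  proof -
    have "including_degree U f R1 x = including_degree U f R1 y" if "(x, y) \<in> R1" for x y
    proof -
      from that have "(x, y) \<in> {(1, 1), (2, 2), (3, 3)} \<union> {4, 5, 6} \<times> {4, 5, 6}"
        by (simp only: R1_eq)
      then show ?thesis
        using deg1 by auto
    qed
    then show ?thesis
      by auto
  qed
  then have map1: "relation_mapping U f R1 = {(a, a), (b, b), (a, b), (b, a)}"
    unfolding image_eq by (simp only:) (use f_a f_b in \<open>auto simp: R1_eq\<close>)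
  \<comment> \<open>\<open>A\<close> is the fibre over \<open>a\<close>. The large class of
    \<open>R2\<close> is \<open>A\<close> with the single point 4 over \<open>b\<close>
    added.\<close>
  define A :: "nat set" where "A = {1, 2, 5, 6}"
  have "R2 = {(3, 3)} \<union> insert 4 A \<times> insert 4 A"
    unfolding R2_eq A_def by (simp add: insert_commute)
  moreover have "including_degree U f R2 x = 1" if "x \<in> A" for x
    using that deg2 by (auto simp: A_def)
  \<comment> \<open>Degree 1 on \<open>A\<close> against 1/2 at 4 removes the pairs between 4 and
    \<open>A\<close>.\<close>
  ultimately have "{(x, y) \<in> R2. including_degree U f R2 x = including_degree U f R2 y} =
      {(3, 3), (4, 4)} \<union> A \<times> A"
    using deg2(3,4) by auto
  then have map2: "relation_mapping U f R2 = {(a, a), (b, b)}"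
    unfolding image_eq by (simp only:) (use f_a f_b in \<open>auto simp: A_def\<close>)
  have "R1 \<subseteq> R2"
    unfolding R1_eq R2_eq by auto
  then show ?thesis
    unfolding map1 map2 by auto
qed

end
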